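(* Let $x$ be a real number with $0<x\le 1/e$. Define sequences by $z_1=z_1'=2$ and, for $n\ge 1$, $$l_n=-\frac{3z_nx-\ln z_n-2}{x},\quad m_n=\frac{2z_n(\ln z_n-z_nx)}{x},\quad a_n=\tfrac12\left(l_n+\sqrt{l_n^2+4m_n}\right),\quad z_{n+1}=z_n+a_n,$$ $$l_n'=-\frac{3z_n'x-\ln z_n'-2}{x},\quad m_n'=\frac{2z_n'(\ln z_n'-z_n'x)}{x},\quad a_n'=\tfrac12\left(l_n'-\sqrt{l_n'^2+4m_n'}\right),\quad z_{n+1}'=z_n'+a_n'.$$ Assume that all the numbers $z_n$ and $z_n'$ ($n\ge1$) are real and positive. Then one of the two real solutions $y$ of $-ye^{-y}=-x$ (i.e. of $W(-x)=-y$) is evaluated to any required accuracy by $\ln(z_n+a_n)$, and the second one by $\ln(z_n'+a_n')$, with $n$ large enough; that is, $\lim_{n\to\infty}\ln(z_n+a_n)$ and $\lim_{n\to\infty}\ln(z_n'+a_n')$ exist and are the two real solutions of $ye^{-y}=x$.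
   Context: $W$ denotes the real (two-branched) Lambert W relation: $W(-x)=-y$ means $-ye^{-y}=-x$. For $0<x<1/e$ the equation $ye^{-y}=x$ has exactly two real solutions, one in $(0,1)$ and one in $(1,\infty)$; for $x=1/e$ they coincide (both equal $1$). The integer $n$ is the number of times the correction is applied. *)

theory Defs
  imports Complex_Main
begin

text \<open>
  The real, two-branched Lambert W relation: \<open>lambert_W u v\<close> reads ``\<open>W(u) = v\<close>''.  It is a
  relation and not a function, since \<open>u\<close> has two values \<open>v\<close> for \<open>-1/e < u < 0\<close>.
\<close>
definition lambert_W :: "real \<Rightarrow> real \<Rightarrow> bool"
  where "lambert_W u v \<longleftrightarrow> v * exp v = u"

end

theory Submission
  imports Defs "HOL-Probability.Characteristic_Functions"
begin

text \<open>
  Substituting \<open>z = exp y\<close> turns \<open>y * exp (- y) = x\<close> into \<open>ln z = x * z\<close>.  The residual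
  \<open>ln z - x * z\<close> is strictly concave in \<open>z\<close>, so it has at most two zeros and is positive exactly
  between them.  One correction replaces the logarithm by its Pade approximation
  \<open>pade_ln z w = ln z + 2 * (w - z) / (w + z)\<close> around the current point \<open>z\<close> and solves
  \<open>pade_ln z w = x * w\<close> for \<open>w\<close>.  Clearing the denominator leaves a quadratic in the correction
  \<open>w - z\<close>; the unprimed sequence takes its larger root and the primed one its smaller root.
  The approximation lies below the logarithm to the right of \<open>z\<close> and above it to the left of \<open>z\<close>.
  Hence a correction that moves to the right ends at a point of positive residual, and one that
  moves to the left ends at a point of negative residual.

  \<^emph>\<open>Larger root.\<close>  The first correction from 2 goes to the right whatever the sign of the residual
  at 2, so from then on the residual is positive.  Positive residual forces the next correction to
  the right again: the sequence increases, stays bounded, and its limit is a zero of the residual,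
  namely the larger one (\<open>upper_orbit_converges\<close>).

  \<^emph>\<open>Smaller root.\<close>  Here the iterates alternate around the smaller zero: positive residual sends
  the point to the left, and from there the next correction leads to the right again.
  The points of nonnegative residual below \<open>e\<close> are compared two steps apart.  An explicit computation (\<open>no_two_cycle_below_e\<close>) shows that
  two steps strictly decrease such a point unless it is already a zero, and that a limiting
  two-cycle cannot exist either; so the whole sequence converges to a zero
  (\<open>lower_orbit_converges\<close>).  The bound \<open>e\<close> matters: two-cycles of the iteration with a point
  above \<open>e\<close> do exist for small \<open>x\<close>.  The start 2 lies below \<open>e\<close>; if its residual is negative, the
  first correction leads to the right and the product of the two roots of the quadratic shows that
  it stops short of \<open>e\<close> (\<open>first_lower_step_below_e\<close>).

  The lower limit is at most the second upper iterate, and the upper limit is strictly above it.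
  So the two limits are distinct and are all the zeros there are.
\<close>

section \<open>The Pade approximation of the logarithm\<close>

definition pade_ln :: "real \<Rightarrow> real \<Rightarrow> real"
  where "pade_ln z w = ln z + 2 * (w - z) / (w + z)"

lemma pade_ln_self [simp]: "pade_ln z z = ln z"
  by (simp add: pade_ln_def)

text \<open>
  The difference of the two sides vanishes at \<open>w = z\<close> and has derivative
  \<open>(w - z)\<^sup>2 / (w * (w + z)\<^sup>2)\<close> in \<open>w\<close>.
\<close>
lemma pade_ln_less_ln:
  assumes "0 < z" "z < w"
  shows "pade_ln z w < ln w"
proof -
  define g where "g = (\<lambda>w. ln w - ln z - 2 * (w - z) / (w + z))"
  have "g z < g w"
  proof (rule DERIV_pos_imp_increasing_open[OF assms(2)])
    fix s assume s: "z < s" "s < w"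
    have "(g has_real_derivative (1 / s - 4 * z / (s + z)\<^sup>2)) (at s)"
      unfolding g_def using s assms
      by (auto intro!: derivative_eq_intros simp: field_simps power2_eq_square)
    moreover have "1 / s - 4 * z / (s + z)\<^sup>2 = (s - z)\<^sup>2 / (s * (s + z)\<^sup>2)"
      using s assms by (simp add: field_simps) (simp add: power2_eq_square algebra_simps)
    moreover have "0 < (s - z)\<^sup>2 / (s * (s + z)\<^sup>2)"
      using s assms by simp
    ultimately show "\<exists>y. (g has_real_derivative y) (at s) \<and> 0 < y"
      by auto
  next
    show "continuous_on {z..w} g"
      unfolding g_def using assms by (auto intro!: continuous_intros)
  qed
  then show ?thesis
    by (simp add: g_def pade_ln_def)
qed

text \<open>
  The mirror image of \<open>pade_ln_less_ln\<close>: exchanging \<open>z\<close> and \<open>w\<close> changes the sign of the rational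
  term of \<open>pade_ln\<close>.
\<close>
lemma ln_less_pade_ln:
  assumes "0 < w" "w < z"
  shows "ln w < pade_ln z w"
proof -
  have "2 * (w - z) / (w + z) = - (2 * (z - w) / (z + w))"
    by (simp add: minus_divide_left add.commute)
  then show ?thesis
    using pade_ln_less_ln[OF assms] by (simp add: pade_ln_def)
qed

section \<open>One correction as a root of a quadratic\<close>

text \<open>
  For positive \<open>x\<close>, \<open>z\<close> and \<open>w\<close>, the correction \<open>a = w - z\<close> solves \<open>pade_ln z w = x * w\<close> iff
  \<open>a\<^sup>2 = lin_coeff x z * a + const_coeff x z\<close>.
\<close>
definition lin_coeff :: "real \<Rightarrow> real \<Rightarrow> real"
  where "lin_coeff x z = - ((3 * z * x - ln z - 2) / x)"

definition const_coeff :: "real \<Rightarrow> real \<Rightarrow> real"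
  where "const_coeff x z = (2 * z * (ln z - z * x)) / x"

definition discr :: "real \<Rightarrow> real \<Rightarrow> real"
  where "discr x z = (lin_coeff x z)\<^sup>2 + 4 * const_coeff x z"

definition upper_step :: "real \<Rightarrow> real \<Rightarrow> real"
  where "upper_step x z = z + 1 / 2 * (lin_coeff x z + sqrt (discr x z))"

definition lower_step :: "real \<Rightarrow> real \<Rightarrow> real"
  where "lower_step x z = z + 1 / 2 * (lin_coeff x z - sqrt (discr x z))"

text \<open>
  The central identity: the defect of the approximate equation at an arbitrary point \<open>w\<close> is, up to
  a positive factor, the quadratic whose roots are the two possible next iterates.  Its sign at \<open>w\<close>
  therefore tells on which side of these iterates \<open>w\<close> lies.
\<close>
lemma step_factorization:
  assumes "0 < x" "0 < z" "0 < w + z" "0 \<le> discr x z"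
  shows "(w + z) * (pade_ln z w - x * w)
    = - (x * (w - lower_step x z) * (w - upper_step x z))"
proof -
  have coeffs: "x * lin_coeff x z = - (3 * z * x - ln z - 2)"
      "x * const_coeff x z = 2 * z * (ln z - z * x)"
    using assms(1) by (simp_all add: lin_coeff_def const_coeff_def)
  have *: "(sqrt (discr x z))\<^sup>2 = (lin_coeff x z)\<^sup>2 + 4 * const_coeff x z"
    using assms(4) by (simp add: discr_def)
  have "(w - lower_step x z) * (w - upper_step x z)
      = (w - z)\<^sup>2 - lin_coeff x z * (w - z) + ((lin_coeff x z)\<^sup>2 - (sqrt (discr x z))\<^sup>2) / 4"
    unfolding lower_step_def upper_step_def by (simp add: field_simps power2_eq_square)
  also have "\<dots> = (w - z)\<^sup>2 - lin_coeff x z * (w - z) - const_coeff x z"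
    unfolding * by simp
  finally have "x * ((w - lower_step x z) * (w - upper_step x z))
      = x * (w - z)\<^sup>2 - (x * lin_coeff x z) * (w - z) - x * const_coeff x z"
    by (simp only: right_diff_distrib mult.assoc)
  also have "\<dots> = x * (w - z)\<^sup>2 + (3 * z * x - ln z - 2) * (w - z) - 2 * z * (ln z - z * x)"
    unfolding coeffs by (simp add: algebra_simps)
  also have "\<dots> = - ((w + z) * (ln z - x * w) + 2 * (w - z))"
    by (simp add: algebra_simps power2_eq_square)
  also have "(w + z) * (ln z - x * w) + 2 * (w - z) = (w + z) * (pade_ln z w - x * w)"
    unfolding pade_ln_def using assms(3) by (simp add: field_simps)
  finally show ?thesis
    by (simp add: mult.assoc)
qed

text \<open>
  The case \<open>w = z\<close>, where the approximation is exact: the sign of the residual at \<open>z\<close> decides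
  whether the two next iterates lie on different sides of \<open>z\<close> or on the same side.
\<close>
lemma residual_factorization:
  assumes "0 < x" "0 < z" "0 \<le> discr x z"
  shows "2 * z * (ln z - x * z) = - (x * (lower_step x z - z) * (upper_step x z - z))"
  using step_factorization[of x z z] assms by (simp add: algebra_simps)

lemma lower_le_upper: "0 \<le> discr x z \<Longrightarrow> lower_step x z \<le> upper_step x z"
  by (simp add: lower_step_def upper_step_def)

lemma pade_ln_step:
  assumes "0 < x" "0 < z" "0 < w" "0 \<le> discr x z" "w \<in> {lower_step x z, upper_step x z}"
  shows "pade_ln z w = x * w"
  using step_factorization[of x z w] assms by auto

lemma residual_after_increase:
  assumes "0 < z" "z < w" "pade_ln z w = x * w"
  shows "x * w < ln w"
  using pade_ln_less_ln[of z w] assms by simp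

section \<open>The upper orbit\<close>

lemma upper_step_increases:
  assumes "0 < x" "0 < z" "0 \<le> discr x z" "x * z < ln z"
  shows "z < upper_step x z"
proof (rule ccontr)
  assume "\<not> z < upper_step x z"
  then have "0 \<le> (lower_step x z - z) * (upper_step x z - z)"
    using lower_le_upper[OF assms(3)] by (intro mult_nonpos_nonpos) auto
  then have "0 \<le> x * (lower_step x z - z) * (upper_step x z - z)"
    using assms(1) by (simp add: mult.assoc)
  moreover have "0 < 2 * z * (ln z - x * z)"
    using assms by simp
  ultimately show False
    using residual_factorization[OF assms(1-3)] by linarith
qed

text \<open>
  Any explicit bound serves to make the upper orbit converge; this one comes from
  \<open>ln w = 2 * ln (sqrt w) \<le> 2 * sqrt w\<close>.
\<close>
lemma bounded_of_residual_nonneg: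
  fixes x w :: real
  assumes "0 < x" "0 < w" "x * w \<le> ln w"
  shows "w \<le> 4 / x\<^sup>2"
proof -
  have "ln w = 2 * ln (sqrt w)"
    using assms(2) by (simp add: ln_sqrt)
  also have "\<dots> \<le> 2 * sqrt w"
    using ln_le_minus_one[of "sqrt w"] assms(2) by simp
  finally have "x * sqrt w * sqrt w \<le> 2 * sqrt w"
    using assms by (simp add: mult.assoc)
  then have "x * sqrt w \<le> 2"
    using assms(2) by simp
  then have "(x * sqrt w)\<^sup>2 \<le> 2\<^sup>2"
    using assms by (intro power_mono) auto
  then show ?thesis
    using assms by (simp add: field_simps power_mult_distrib)
qed

lemma upper_orbit_converges:
  assumes x: "0 < x"
    and step: "\<And>n. z (Suc n) = upper_step x (z n)"
    and real: "\<And>n. 0 \<le> discr x (z n)"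
    and pos: "0 < z 0" and start: "x * z 0 < ln (z 0)"
  shows "\<exists>p. z \<longlonglongrightarrow> p \<and> z 0 < p \<and> ln p = x * p"
proof -
  have inv: "0 < z n \<and> x * z n < ln (z n)" for n
  proof (induction n)
    case 0
    then show ?case using pos start by simp
  next
    case (Suc n)
    have less: "z n < z (Suc n)"
      using upper_step_increases[OF x _ real] Suc.IH step by simp
    then have "pade_ln (z n) (z (Suc n)) = x * z (Suc n)"
      using pade_ln_step[OF x _ _ real] Suc.IH step by simp
    then show ?case
      using residual_after_increase[of "z n"] less Suc.IH by fastforce
  qed
  have less: "z n < z (Suc n)" for n
    using upper_step_increases[OF x _ real] inv step by simp
  have "incseq z"
    using less by (intro incseq_SucI less_imp_le)
  moreover have "z n \<le> 4 / x\<^sup>2" for n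
    using bounded_of_residual_nonneg[OF x] inv[of n] by simp
  ultimately obtain p where p: "z \<longlonglongrightarrow> p" and le: "\<And>n. z n \<le> p"
    using incseq_convergent[of z "4 / x\<^sup>2"] by blast
  have "0 < p"
    using le[of 0] pos by simp
  have p': "(\<lambda>n. z (Suc n)) \<longlonglongrightarrow> p"
    using p by (rule LIMSEQ_Suc)
  have "(\<lambda>n. pade_ln (z n) (z (Suc n))) \<longlonglongrightarrow> pade_ln p p"
    unfolding pade_ln_def using \<open>0 < p\<close> by (intro tendsto_intros p p') auto
  moreover have "pade_ln (z n) (z (Suc n)) = x * z (Suc n)" for n
    using pade_ln_step[OF x _ _ real] inv[of n] inv[of "Suc n"] step by simp
  ultimately have "(\<lambda>n. x * z (Suc n)) \<longlonglongrightarrow> ln p"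
    by simp
  moreover have "(\<lambda>n. x * z (Suc n)) \<longlonglongrightarrow> x * p"
    by (intro tendsto_intros p')
  ultimately have "ln p = x * p"
    by (rule LIMSEQ_unique)
  moreover have "z 0 < p"
    using less[of 0] le[of 1] by simp
  ultimately show ?thesis
    using p by blast
qed

section \<open>The lower orbit\<close>

text \<open>
  Suppose the correction of \<open>z\<close> leads down to \<open>w\<close>.  The claim says that the line \<open>x * s\<close> is already
  below the approximation around \<open>w\<close> at \<open>s = z\<close>, so the correction of \<open>w\<close> does not reach back to \<open>z\<close>.
  Eliminating \<open>x\<close> with the hypothesis reduces it to
  \<open>w * (ln z - ln w) < (z - w) * (2 - ln z)\<close>, where the left side is at most \<open>z - w\<close> and
  \<open>ln z < 1\<close>.
\<close>
lemma no_two_cycle_below_e: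
  assumes "0 < w" "w < z" "z < exp 1" "pade_ln z w = x * w"
  shows "x * z < pade_ln w z"
proof -
  define t where "t = 2 * (z - w) / (z + w)"
  have zw: "pade_ln z w = ln z - t" "pade_ln w z = ln w + t"
    by (simp_all add: pade_ln_def t_def field_simps diff_divide_distrib)
  have t: "t * (z + w) = 2 * (z - w)"
    unfolding t_def using assms by simp
  have "ln z < 1"
    using ln_less_cancel_iff[of z "exp 1"] assms by simp
  have "w * ln (z / w) \<le> w * (z / w - 1)"
    using assms by (intro mult_left_mono ln_le_minus_one) auto
  then have "w * (ln z - ln w) \<le> z - w"
    using assms by (simp add: ln_div algebra_simps)
  also have "\<dots> < (z - w) * (2 - ln z)"
    using assms \<open>ln z < 1\<close> by simp
  also have "\<dots> = t * (z + w) - (z - w) * ln z"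
    unfolding t by (simp add: algebra_simps)
  finally have "z * (ln z - t) < w * (ln w + t)"
    by (simp add: algebra_simps)
  moreover have "z * (ln z - t) = w * (x * z)"
    using assms(4) unfolding zw by simp
  ultimately show ?thesis
    using assms(1) unfolding zw by simp
qed

text \<open>
  Nonnegative residual at \<open>u\<close> puts \<open>u\<close> between the two roots, so \<open>w\<close> is on its left and has negative
  residual, unless \<open>w = u\<close>.  The roots of the next quadratic then lie on the same side of \<open>w\<close>, and
  \<open>no_two_cycle_below_e\<close> puts \<open>u\<close> strictly between them.  So both are to the right of \<open>w\<close> and the
  smaller one, \<open>v\<close>, is below \<open>u\<close>; having been reached by a move to the right, it has positive
  residual.
\<close>
lemma two_lower_steps:
  assumes x: "0 < x" and u: "0 < u" "u < exp 1" "x * u \<le> ln u" "0 \<le> discr x u"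
    and w: "w = lower_step x u" "0 < w" "0 \<le> discr x w"
    and v: "v = lower_step x w" "0 < v"
  shows "w \<le> u" "v \<le> u" "x * v \<le> ln v"
proof -
  show "w \<le> u"
  proof (rule ccontr)
    assume "\<not> w \<le> u"
    then have "0 < x * (lower_step x u - u) * (upper_step x u - u)"
      using lower_le_upper[OF u(4)] w(1) x by simp
    moreover have "0 \<le> 2 * u * (ln u - x * u)"
      using u by simp
    ultimately show False
      using residual_factorization[OF x u(1) u(4)] by simp
  qed
  have "v \<le> u \<and> x * v \<le> ln v"
  proof (cases "w = u")
    case True
    then show ?thesis using u v w by simp
  next
    case False
    with \<open>w \<le> u\<close> have "w < u" by simp
    have uw: "pade_ln u w = x * w"
      using pade_ln_step[OF x u(1) w(2) u(4)] w(1) by simp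
    then have "ln w < x * w"
      using ln_less_pade_ln[OF w(2) \<open>w < u\<close>] by simp
    then have "2 * w * (ln w - x * w) < 0"
      using w(2) by (simp add: mult_pos_neg)
    then have same_side: "0 < x * ((v - w) * (upper_step x w - w))"
      using residual_factorization[OF x w(2,3)] v(1) by (simp add: mult.assoc)
    have "x * u < pade_ln w u"
      using no_two_cycle_below_e[OF w(2) \<open>w < u\<close> u(2) uw] .
    then have "0 < (u + w) * (pade_ln w u - x * u)"
      using u(1) w(2) by simp
    then have between: "x * ((u - v) * (u - upper_step x w)) < 0"
      using step_factorization[OF x w(2) _ w(3), of u] u(1) w(2) v(1) by (simp add: mult.assoc)
    have "v \<le> upper_step x w"
      using lower_le_upper[OF w(3)] v(1) by simp
    then have "v < u" "u < upper_step x w"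
      using between x by (auto simp: mult_less_0_iff)
    then have "w < v"
      using same_side x \<open>w < u\<close> by (auto simp: zero_less_mult_iff)
    have "pade_ln w v = x * v"
      using pade_ln_step[OF x w(2) v(2) w(3)] v(1) by simp
    then have "x * v < ln v"
      using residual_after_increase[OF w(2) \<open>w < v\<close>] by simp
    then show ?thesis
      using \<open>v < u\<close> by simp
  qed
  then show "v \<le> u" "x * v \<le> ln v" by auto
qed

text \<open>
  The even iterates decrease to some \<open>p\<close>, and by continuity of the step the odd ones tend to some
  \<open>q \<le> p\<close>.  The pair solves both equations of a two-cycle, which forces \<open>q = p\<close>.
\<close>
lemma lower_orbit_converges:
  assumes x: "0 < x"
    and step: "\<And>n. z (Suc n) = lower_step x (z n)"
    and real: "\<And>n. 0 \<le> discr x (z n)"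
    and pos: "\<And>n. 0 < z n"
    and start: "z 0 < exp 1" "x * z 0 \<le> ln (z 0)"
  shows "\<exists>p. z \<longlonglongrightarrow> p \<and> 0 < p \<and> p \<le> z 0 \<and> ln p = x * p"
proof -
  define u where "u n = z (2 * n)" for n
  define w where "w n = z (Suc (2 * n))" for n
  have w_step: "w n = lower_step x (u n)" and u_step: "u (Suc n) = lower_step x (w n)" for n
    by (simp_all add: u_def w_def step)
  have u: "0 < u n" "0 \<le> discr x (u n)" and w: "0 < w n" "0 \<le> discr x (w n)" for n
    using pos real by (simp_all add: u_def w_def)
  note two = two_lower_steps[OF x u(1) _ _ u(2) w_step w(1) w(2) u_step u(1)]
  have inv: "u n < exp 1 \<and> x * u n \<le> ln (u n)" for n
  proof (induction n)
    case 0
    then show ?case using start by (simp add: u_def)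
  next
    case (Suc n)
    then show ?case using two(2,3)[of n] by linarith
  qed
  have wu: "w n \<le> u n" and dec: "u (Suc n) \<le> u n" for n
    using two(1,2) inv by blast+
  have "1 \<le> u n" for n
  proof -
    have "0 < x * u n"
      using x u(1) by simp
    then have "0 < ln (u n)"
      using inv[of n] by linarith
    then show ?thesis
      using u(1)[of n] by simp
  qed
  moreover have "decseq u"
    using dec by (rule decseq_SucI)
  ultimately obtain p where p: "u \<longlonglongrightarrow> p" and le: "\<And>n. p \<le> u n"
    using decseq_convergent[of u 1] by blast
  have "1 \<le> p"
    using p \<open>\<And>n. 1 \<le> u n\<close> by (intro LIMSEQ_le_const) auto
  have "p < exp 1"
    using le[of 0] inv[of 0] by simp
  then have "ln p < 1"
    using ln_less_cancel_iff[of p "exp 1"] \<open>1 \<le> p\<close> by simp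
  define q where "q = lower_step x p"
  have "isCont (lower_step x) p"
    unfolding lower_step_def discr_def lin_coeff_def const_coeff_def
    using x \<open>1 \<le> p\<close> by (intro continuous_intros) auto
  then have q: "w \<longlonglongrightarrow> q"
    unfolding q_def w_step[abs_def] using p by (rule isCont_tendsto_compose)
  have u': "(\<lambda>n. u (Suc n)) \<longlonglongrightarrow> p"
    using p by (rule LIMSEQ_Suc)
  have "q \<le> p"
    using wu by (intro LIMSEQ_le[OF q p]) auto
  have "0 \<le> q"
    using w(1) by (intro LIMSEQ_le_const[OF q]) (auto intro: less_imp_le)
  have uw: "pade_ln (u n) (w n) = x * w n" and wu': "pade_ln (w n) (u (Suc n)) = x * u (Suc n)" for n
    using pade_ln_step[OF x u(1) w(1) u(2), of n n] w_step[of n]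
      pade_ln_step[OF x w(1) u(1) w(2), of "Suc n" n] u_step[of n]
    by (metis insertI1)+
  have "(\<lambda>n. pade_ln (u n) (w n)) \<longlonglongrightarrow> pade_ln p q"
    unfolding pade_ln_def using \<open>1 \<le> p\<close> \<open>0 \<le> q\<close> by (intro tendsto_intros p q) auto
  moreover have "(\<lambda>n. x * w n) \<longlonglongrightarrow> x * q"
    by (intro tendsto_intros q)
  ultimately have pq: "pade_ln p q = x * q"
    unfolding uw by (rule LIMSEQ_unique)
  \<comment> \<open>Positivity of the odd iterates only gives \<open>0 \<le> q\<close>; at \<open>q = 0\<close> the equation for \<open>q\<close>
      would read \<open>ln p = 2\<close>, but \<open>p < e\<close>.\<close>
  have "q \<noteq> 0"
  proof
    assume "q = 0"
    then have "ln p = 2" using pq \<open>1 \<le> p\<close> by (simp add: pade_ln_def)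
    then show False using \<open>ln p < 1\<close> by simp
  qed
  with \<open>0 \<le> q\<close> have "0 < q" by simp
  have "(\<lambda>n. pade_ln (w n) (u (Suc n))) \<longlonglongrightarrow> pade_ln q p"
    unfolding pade_ln_def using \<open>1 \<le> p\<close> \<open>0 < q\<close> by (intro tendsto_intros u' q) auto
  moreover have "(\<lambda>n. x * u (Suc n)) \<longlonglongrightarrow> x * p"
    by (intro tendsto_intros u')
  ultimately have qp: "pade_ln q p = x * p"
    unfolding wu' by (rule LIMSEQ_unique)
  have "q = p"
    using no_two_cycle_below_e[OF \<open>0 < q\<close> _ \<open>p < exp 1\<close> pq] qp \<open>q \<le> p\<close> by fastforce
  have "z \<longlonglongrightarrow> p"
    using limseq_even_odd[of z p] p q \<open>q = p\<close> unfolding u_def[abs_def] w_def[abs_def] by simp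
  moreover have "ln p = x * p"
    using qp \<open>q = p\<close> by simp
  ultimately show ?thesis
    using \<open>1 \<le> p\<close> le[of 0] by (intro exI[of _ p]) (simp add: u_def)
qed

section \<open>The solutions of the equation\<close>

text \<open>
  The logarithm lies strictly below its tangent at \<open>b\<close>.  Zeros on both sides of \<open>b\<close> would force the
  slope \<open>x\<close> to be both larger and smaller than the slope \<open>1 / b\<close> of that tangent.
\<close>
lemma no_three_roots:
  fixes x :: real
  assumes "0 < a" "a < b" "b < c" "ln a = x * a" "ln b = x * b" "ln c = x * c"
  shows False
proof -
  have chord: "ln s < ln b + (s - b) / b" if "0 < s" "s \<noteq> b" for s
  proof -
    have "ln (s / b) \<noteq> s / b - 1"
      using ln_eq_minus_one[of "s / b"] that assms by auto
    moreover have "ln (s / b) \<le> s / b - 1"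
      using that assms by (intro ln_le_minus_one) simp
    ultimately show ?thesis
      using that assms by (simp add: ln_div diff_divide_distrib)
  qed
  have "x * (a - b) < (a - b) / b" "x * (c - b) < (c - b) / b"
    using chord[of a] chord[of c] assms by (auto simp: algebra_simps)
  then have "(1 / b - x) * (b - a) < 0" "0 < (1 / b - x) * (c - b)"
    by (simp_all add: algebra_simps diff_divide_distrib)
  then show False
    using assms by (simp add: mult_less_0_iff zero_less_mult_iff)
qed

lemma lambert_W_solutions:
  assumes "0 < p'" "p' < p" "ln p' = x * p'" "ln p = x * p"
  shows "{t. lambert_W (- x) (- t)} = {ln p, ln p'}"
proof -
  have iff: "lambert_W (- x) (- t) \<longleftrightarrow> ln (exp t) = x * exp t" for t
    by (simp add: lambert_W_def exp_minus field_simps)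
  have "exp t = p \<or> exp t = p'" if "ln (exp t) = x * exp t" for t
  proof (rule ccontr)
    assume "\<not> (exp t = p \<or> exp t = p')"
    then consider "exp t < p'" | "p' < exp t" "exp t < p" | "p < exp t"
      by linarith
    then show False
      using no_three_roots[of "exp t" p' p x] no_three_roots[of p' "exp t" p x] no_three_roots[of p' p "exp t" x] assms that by cases auto
  qed
  then have "lambert_W (- x) (- t) \<longleftrightarrow> t = ln p \<or> t = ln p'" for t
    unfolding iff using assms by (metis exp_ln less_trans ln_exp)
  then show ?thesis by blast
qed

section \<open>The first correction from 2\<close>

lemma exp_1_ge: "(2.718 :: real) \<le> exp 1"
  using e_approx_32 by (simp add: abs_if split: if_split_asm)

text \<open>
  Writing 2 as \<open>(4/3) * (5/4) * (6/5)\<close> makes \<open>pade_ln_less_ln\<close> around 1 sharp enough for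
  \<open>first_lower_step_below_e\<close>, where the margin is small.
\<close>
lemma ln_2_ge: "2/7 + 2/9 + 2/11 \<le> ln (2 :: real)"
proof -
  have "ln (2 :: real) = ln ((4/3) * (5/4) * (6/5))"
    by simp
  also have "\<dots> = ln (4/3) + ln (5/4) + ln (6/5)"
    by (simp only: ln_mult_pos)
  finally show ?thesis
    using pade_ln_less_ln[of 1 "4/3"] pade_ln_less_ln[of 1 "5/4"] pade_ln_less_ln[of 1 "6/5"]
    by (simp add: pade_ln_def)
qed

text \<open>
  When the first correction goes to the right, both roots do, and the square of the smaller
  correction is at most the product of the two.  The product is \<open>4 * (2 - ln 2 / x)\<close>, hence at most
  \<open>4 * (2 - e * ln 2)\<close>, which is less than \<open>(e - 2)\<^sup>2\<close>.
\<close>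
lemma first_lower_step_below_e:
  assumes x: "0 < x" "x \<le> 1 / exp 1" and real: "0 \<le> discr x 2"
    and gt: "2 < lower_step x 2"
  shows "lower_step x 2 < exp 1"
proof -
  have "x * (lower_step x 2 - 2)\<^sup>2 \<le> x * ((lower_step x 2 - 2) * (upper_step x 2 - 2))"
    using gt lower_le_upper[OF real] x unfolding power2_eq_square
    by (intro mult_left_mono) auto
  also have "\<dots> = 4 * (2 * x - ln 2)"
    using residual_factorization[OF x(1) _ real] by (simp add: algebra_simps)
  also have "\<dots> \<le> 4 * (2 * x - (x * exp 1) * ln 2)"
    using x by (simp add: field_simps)
  finally have "x * (lower_step x 2 - 2)\<^sup>2 \<le> x * (4 * (2 - exp 1 * ln 2))"
    by (simp add: algebra_simps)
  then have "(lower_step x 2 - 2)\<^sup>2 \<le> 4 * (2 - exp 1 * ln 2)"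
    using x(1) by simp
  also have "\<dots> \<le> 4 * (2 - 2.718 * (2/7 + 2/9 + 2/11))"
    using mult_mono[OF exp_1_ge ln_2_ge] by simp
  also have "\<dots> < (0.718 :: real)\<^sup>2"
    by (simp add: power2_eq_square)
  finally have "lower_step x 2 - 2 < 0.718"
    by (rule power_less_imp_less_base) simp
  then show ?thesis
    using exp_1_ge by simp
qed

text \<open>
  The two corrections have the sum \<open>lin_coeff x 2\<close>, which is positive because \<open>6 * x < 2 + ln 2\<close>.
\<close>
lemma first_upper_step_increases:
  assumes "0 < x" "x \<le> 1 / exp 1" "0 \<le> discr x 2"
  shows "2 < upper_step x 2"
proof -
  have "1 / exp 1 \<le> (1 / 2.718 :: real)"
    using exp_1_ge by (intro divide_left_mono) auto
  then have "6 * x < 2 + ln 2"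
    using assms ln_2_ge by simp
  then have "0 < lin_coeff x 2"
    using assms by (simp add: lin_coeff_def field_simps)
  then show ?thesis
    using assms by (simp add: upper_step_def add_pos_nonneg)
qed

theorem lemma4p1:
  fixes x :: real
    and z l m a z' l' m' a' :: "nat \<Rightarrow> real"
  assumes x: "0 < x" "x \<le> 1 / exp 1"
    and z_1: "z 1 = 2"
    and l: "\<And>n. n \<ge> 1 \<Longrightarrow> l n = - ((3 * z n * x - ln (z n) - 2) / x)"
    and m: "\<And>n. n \<ge> 1 \<Longrightarrow> m n = (2 * z n * (ln (z n) - z n * x)) / x"
    and a: "\<And>n. n \<ge> 1 \<Longrightarrow> a n = 1 / 2 * (l n + sqrt ((l n)\<^sup>2 + 4 * m n))"
    and z_Suc: "\<And>n. n \<ge> 1 \<Longrightarrow> z (n + 1) = z n + a n"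
    and z'_1: "z' 1 = 2"
    and l': "\<And>n. n \<ge> 1 \<Longrightarrow> l' n = - ((3 * z' n * x - ln (z' n) - 2) / x)"
    and m': "\<And>n. n \<ge> 1 \<Longrightarrow> m' n = (2 * z' n * (ln (z' n) - z' n * x)) / x"
    and a': "\<And>n. n \<ge> 1 \<Longrightarrow> a' n = 1 / 2 * (l' n - sqrt ((l' n)\<^sup>2 + 4 * m' n))"
    and z'_Suc: "\<And>n. n \<ge> 1 \<Longrightarrow> z' (n + 1) = z' n + a' n"
    (* HOL's sqrt is total on the reals (sqrt (- t) = - sqrt t), so that the numbers are
       genuinely real has to be said through the radicands. *)
    and z_real: "\<And>n. n \<ge> 1 \<Longrightarrow> (l n)\<^sup>2 + 4 * m n \<ge> 0"
    and z_pos: "\<And>n. n \<ge> 1 \<Longrightarrow> z n > 0"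
    and z'_real: "\<And>n. n \<ge> 1 \<Longrightarrow> (l' n)\<^sup>2 + 4 * m' n \<ge> 0"
    and z'_pos: "\<And>n. n \<ge> 1 \<Longrightarrow> z' n > 0"
  shows "\<exists>y y'. (\<lambda>n. ln (z n + a n)) \<longlonglongrightarrow> y \<and>
                (\<lambda>n. ln (z' n + a' n)) \<longlonglongrightarrow> y' \<and>
                {t. lambert_W (- x) (- t)} = {y, y'}"
proof -
  have dz: "discr x (z n) = (l n)\<^sup>2 + 4 * m n" and dz': "discr x (z' n) = (l' n)\<^sup>2 + 4 * m' n"
    if "n \<ge> 1" for n
    using that by (simp_all add: discr_def lin_coeff_def const_coeff_def l m l' m')
  have real: "0 \<le> discr x (z n)" and real': "0 \<le> discr x (z' n)" if "n \<ge> 1" for n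
    using that z_real z'_real by (simp_all add: dz dz')
  have step: "z (Suc n) = upper_step x (z n)" and step': "z' (Suc n) = lower_step x (z' n)"
    if "n \<ge> 1" for n
    using that z_Suc[of n] z'_Suc[of n] dz[of n] dz'[of n]
    by (simp_all add: upper_step_def lower_step_def a a' l l' lin_coeff_def)
  have real2: "0 \<le> discr x 2"
    using real[of 1] z_1 by simp
  have z2: "z 2 = upper_step x 2" and z'2: "z' 2 = lower_step x 2"
    using step[of 1] step'[of 1] z_1 z'_1 by (simp_all add: numeral_2_eq_2)
  have "2 < z 2"
    using first_upper_step_increases[OF x real2] z2 by simp
  have "pade_ln 2 (z 2) = x * z 2"
    using pade_ln_step[OF x(1) _ _ real2, of "z 2"] z_pos[of 2] z2 by simp
  then have "x * z 2 < ln (z 2)"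
    using residual_after_increase[of 2 "z 2" x] \<open>2 < z 2\<close> by simp
  then obtain p where p: "(\<lambda>n. z (n + 2)) \<longlonglongrightarrow> p" "z 2 < p" "ln p = x * p"
    using upper_orbit_converges[of x "\<lambda>n. z (n + 2)", unfolded add_Suc, OF x(1) step real]
      z_pos[of 2] by (auto simp: numeral_2_eq_2)
  \<comment> \<open>The lower orbit is followed from its first point of nonnegative residual: \<open>k = 1\<close>, or \<open>k = 2\<close>
      if 2 lies to the left of the smaller zero.\<close>
  have "\<exists>k\<ge>1. z' k < exp 1 \<and> x * z' k \<le> ln (z' k) \<and> z' k \<le> z 2"
  proof (cases "x * 2 \<le> ln 2")
    case True
    then show ?thesis
      using \<open>2 < z 2\<close> z'_1 exp_1_ge by (intro exI[of _ 1]) simp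
  next
    case False
    then have "0 < x * ((z' 2 - 2) * (z 2 - 2))"
      using residual_factorization[OF x(1) _ real2] z2 z'2 by (simp add: mult.assoc)
    then have "2 < z' 2"
      using x(1) \<open>2 < z 2\<close> by (auto simp: zero_less_mult_iff)
    have "pade_ln 2 (z' 2) = x * z' 2"
      using pade_ln_step[OF x(1) _ _ real2, of "z' 2"] z'_pos[of 2] z'2 by simp
    then have "x * z' 2 < ln (z' 2)"
      using residual_after_increase[of 2 "z' 2" x] \<open>2 < z' 2\<close> by simp
    moreover have "z' 2 < exp 1"
      using first_lower_step_below_e[OF x real2] \<open>2 < z' 2\<close> z'2 by simp
    ultimately show ?thesis
      using lower_le_upper[OF real2] z2 z'2 by (intro exI[of _ 2]) simp
  qed
  then obtain k where k: "k \<ge> 1" "z' k < exp 1" "x * z' k \<le> ln (z' k)" "z' k \<le> z 2"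
    by blast
  then obtain p' where p': "(\<lambda>n. z' (n + k)) \<longlonglongrightarrow> p'" "0 < p'" "p' \<le> z' k" "ln p' = x * p'"
    using lower_orbit_converges[of x "\<lambda>n. z' (n + k)", unfolded add_Suc, OF x(1) step' real' z'_pos]
    by auto
  have "z \<longlonglongrightarrow> p" "z' \<longlonglongrightarrow> p'"
    using LIMSEQ_offset[OF p(1)] LIMSEQ_offset[OF p'(1)] by auto
  then have "(\<lambda>n. ln (z (Suc n))) \<longlonglongrightarrow> ln p" "(\<lambda>n. ln (z' (Suc n))) \<longlonglongrightarrow> ln p'"
    using p(2) p'(2) \<open>2 < z 2\<close> by (auto intro!: tendsto_ln LIMSEQ_Suc)
  \<comment> \<open>The recursion starts at index 1, so the identification with the shifted sequence is only eventual.\<close>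
  moreover have "\<forall>\<^sub>F n in sequentially. ln (z (Suc n)) = ln (z n + a n)"
    "\<forall>\<^sub>F n in sequentially. ln (z' (Suc n)) = ln (z' n + a' n)"
    using z_Suc z'_Suc by (auto simp: eventually_sequentially intro!: exI[of _ 1])
  ultimately have "(\<lambda>n. ln (z n + a n)) \<longlonglongrightarrow> ln p" "(\<lambda>n. ln (z' n + a' n)) \<longlonglongrightarrow> ln p'"
    by (auto elim: Lim_transform_eventually)
  moreover have "{t. lambert_W (- x) (- t)} = {ln p, ln p'}"
    using lambert_W_solutions[OF p'(2) _ p'(4) p(3)] p(2) p'(3) k(4) by simp
  ultimately show ?thesis
    by blast
qed

end
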